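(* Let $P=\mathbb R^n/2\pi\mathbb Z^n$ carry the constant Poisson structure given by an invertible skew-symmetric $n\times n$ matrix $\eta$. For $r\in\mathbb Z^n$ let $f_r:TP=\mathbb R^n\times P\to\mathbb C$, $f_r(X,q)=e^{i\langle r,q\rangle}e^{\frac12 i\langle r,X\rangle}$. Then for all $r,r'\in\mathbb Z^n$ $$\mathcal Q(f_r)\star\mathcal Q(f_{r'})=\mathcal Q\big(e^{i\frac{\hbar}{2}\langle r,\eta(r')\rangle}f_{r+r'}\big),$$ i.e. $(\mathcal Q(f_r)\star\mathcal Q(f_{r'}))_{(\hbar,q)}=e^{i\frac{\hbar}{2}\langle r,\eta(r')\rangle}\mathcal Q(f_{r+r'})_{(\hbar,q)}$ for all $(\hbar,q)\in\mathbb R\times P$.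
   Context: $\langle\,,\rangle$ is the euclidean product on $\mathbb R^n$; it is used to identify $T^*P$ and $TP$ with $\mathbb R^n\times P$. The Lie algebroid is $A=T^*P$ (anchor $\eta$), with dual $A^*=TP$. The tangent groupoid is $\widetilde G=\mathbb R\times\mathbb R^n\times P\rightrightarrows\mathbb R\times P$ with $\widetilde s(\hbar,u,q)=(\hbar,q)$, $\widetilde t(\hbar,u,q)=(\hbar,q+\hbar u)$, and product $(\hbar,v,q+\hbar u)\cdot(\hbar,u,q)=(\hbar,v+u,q)$. For $f$ among the functions considered, $\mathcal Q(f)$ is the family of linear forms on $C^\infty_c(\widetilde s^{-1}(\hbar,q))$ given, for $H\in C^\infty_c(\widetilde G)$, by $$\mathcal Q(f)_{(\hbar,q)}(H)=\int_{\mathbb R^n}\mathrm dX\,f(X,q)\int_{\mathbb R^n}\mathrm d\xi\,e^{-i\langle\xi,X\rangle}H(\hbar,\eta(\xi),q),$$ where the Lebesgue measures $\mathrm dX,\mathrm d\xi$ are normalised dually, so that Fourier inversion holds without extra constants. The same formula defines $\mathcal Q$ for functions that also depend on the parameter $\hbar$. The product is $(D\star E)_{(\hbar,q)}(h)=E_{(\hbar,q)}\big(z\mapsto D_{\widetilde t(z)}(x\mapsto h(xz))\big)$, for $h\in C^\infty_c(\widetilde s^{-1}(\hbar,q))$, $z\in\widetilde s^{-1}(\hbar,q)$, $x\in\widetilde s^{-1}(\widetilde t(z))$. *)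

theory Defs
  imports "HOL-Analysis.Analysis"
begin

definition ivec :: "int ^ 'n \<Rightarrow> real ^ ('n::finite)" where
  "ivec k = (\<chi> i. real_of_int (k $ i))"

lemma ivec_0: "ivec 0 = 0"
  by (simp add: ivec_def vec_eq_iff)

lemma ivec_minus: "ivec (- k) = - ivec k"
  by (simp add: ivec_def vec_eq_iff)

lemma ivec_add: "ivec (k + l) = ivec k + ivec l"
  by (simp add: ivec_def vec_eq_iff)

lemma inner_ivec: "ivec k \<bullet> ivec l = real_of_int (\<Sum>i\<in>UNIV. k $ i * l $ i)"
  by (simp add: ivec_def inner_vec_def)

definition torus_rel :: "real ^ ('n::finite) \<Rightarrow> real ^ 'n \<Rightarrow> bool" where
  "torus_rel x y \<longleftrightarrow> (\<exists>k. x - y = (2 * pi) *\<^sub>R ivec k)"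

lemma equivp_torus_rel: "equivp torus_rel"
proof (rule equivpI)
  show "reflp torus_rel"
    unfolding reflp_def torus_rel_def by (metis ivec_0 diff_self scaleR_zero_right)
  show "symp torus_rel"
    unfolding symp_def torus_rel_def by (metis ivec_minus minus_diff_eq scaleR_minus_right)
  show "transp torus_rel"
  proof (rule transpI)
    fix x y z :: "real ^ 'n"
    assume "torus_rel x y" "torus_rel y z"
    then obtain k l where "x - y = (2 * pi) *\<^sub>R ivec k" "y - z = (2 * pi) *\<^sub>R ivec l"
      unfolding torus_rel_def by blast
    then have "x - z = (2 * pi) *\<^sub>R ivec (k + l)"
      by (simp add: ivec_add scaleR_add_right algebra_simps)
    then show "torus_rel x z"
      unfolding torus_rel_def by blast
  qed
qed

quotient_type (overloaded) 'n torus = "real ^ ('n::finite)" / torus_rel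
  by (rule equivp_torus_rel)

lift_definition torus_shift :: "'n::finite torus \<Rightarrow> real ^ 'n \<Rightarrow> 'n torus" is "\<lambda>x u. x + u"
  by (simp add: torus_rel_def)

text \<open>The character \<open>q \<mapsto> exp (i \<langle>r, q\<rangle>)\<close> of the torus, for \<open>r\<close> in the integer lattice.\<close>

lift_definition torus_char :: "int ^ 'n \<Rightarrow> 'n::finite torus \<Rightarrow> complex"
  is "\<lambda>r x. exp (\<i> * complex_of_real (ivec r \<bullet> x))"
proof -
  fix r :: "int ^ 'n" and x y :: "real ^ 'n"
  assume "torus_rel x y"
  then obtain k where "x - y = (2 * pi) *\<^sub>R ivec k"
    unfolding torus_rel_def by blast
  then have "x = y + (2 * pi) *\<^sub>R ivec k"
    by (simp add: algebra_simps)
  then have "ivec r \<bullet> x = ivec r \<bullet> y + 2 * pi * real_of_int (\<Sum>i\<in>UNIV. r $ i * k $ i)"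
    by (simp add: inner_add_right inner_ivec)
  then have "\<i> * complex_of_real (ivec r \<bullet> x) = \<i> * complex_of_real (ivec r \<bullet> y)
      + complex_of_real (of_int (2 * (\<Sum>i\<in>UNIV. r $ i * k $ i)) * pi) * \<i>"
    by (simp add: algebra_simps)
  then show "exp (\<i> * complex_of_real (ivec r \<bullet> x)) = exp (\<i> * complex_of_real (ivec r \<bullet> y))"
    unfolding exp_eq by blast
qed

text \<open>The tangent groupoid: arrows \<open>(hbar, u, q)\<close>, objects \<open>(hbar, q)\<close>.
  The product \<open>gmult x z\<close> is written \<open>x z\<close> (first \<open>z\<close>, then \<open>x\<close>); it is meaningful only if
  \<open>gsource x = gtarget z\<close>, and the definition ignores the redundant components of \<open>x\<close>.\<close>

type_synonym 'n obj = "real \<times> 'n torus"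
type_synonym 'n arrow = "real \<times> (real ^ 'n) \<times> 'n torus"

fun gsource :: "'n::finite arrow \<Rightarrow> 'n obj" where
  "gsource (hbar, u, q) = (hbar, q)"

fun gtarget :: "'n::finite arrow \<Rightarrow> 'n obj" where
  "gtarget (hbar, u, q) = (hbar, torus_shift q (hbar *\<^sub>R u))"

fun gmult :: "'n::finite arrow \<Rightarrow> 'n arrow \<Rightarrow> 'n arrow" where
  "gmult (_, v, _) (hbar, u, q) = (hbar, v + u, q)"

definition sfibre :: "'n::finite obj \<Rightarrow> 'n arrow set" where
  "sfibre p = {z. gsource z = p}"

fun C_times :: "nat \<Rightarrow> ('a::real_normed_vector \<Rightarrow> 'b::real_normed_vector) \<Rightarrow> bool" where
  "C_times 0 f \<longleftrightarrow> continuous_on UNIV f"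
| "C_times (Suc k) f \<longleftrightarrow>
     (\<forall>x. f differentiable (at x)) \<and> (\<forall>v. C_times k (\<lambda>x. frechet_derivative f (at x) v))"

definition smooth :: "('a::real_normed_vector \<Rightarrow> 'b::real_normed_vector) \<Rightarrow> bool" where
  "smooth f \<longleftrightarrow> (\<forall>k. C_times k f)"

text \<open>Smooth compactly supported functions on the source fibre over \<open>(hbar, q)\<close>, which is
  identified with the vector space by \<open>u \<mapsto> (hbar, u, q)\<close>.  A function on the fibre is encoded as an
  extensional function: it is \<open>undefined\<close> outside the fibre.\<close>

definition Cc_inf :: "'n::finite obj \<Rightarrow> ('n arrow \<Rightarrow> complex) set" where
  "Cc_inf p = {h \<in> extensional (sfibre p).
     smooth (\<lambda>u. h (fst p, u, snd p)) \<and> compact (closure {u. h (fst p, u, snd p) \<noteq> 0})}"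

text \<open>Families of forms indexed by the objects; the member at \<open>p\<close> is again encoded as a function
  that is \<open>undefined\<close> outside \<open>Cc_inf p\<close>.\<close>

type_synonym 'n form_family = "'n obj \<Rightarrow> ('n arrow \<Rightarrow> complex) \<Rightarrow> complex"

text \<open>The quantisation map for functions of \<open>(hbar, X, q)\<close>, with anchor \<open>\<xi> \<mapsto> \<eta> \<xi>\<close>.
  Of the dual normalisations of the two Lebesgue measures only the product of the constants
  matters; here the factor \<open>(2 \<pi>)\<^sup>-\<^sup>n\<close> required by Fourier inversion is put on \<open>d\<xi>\<close>.\<close>

definition Q_param ::
    "real ^ 'n ^ 'n \<Rightarrow> (real \<Rightarrow> (real ^ 'n) \<times> 'n torus \<Rightarrow> complex) \<Rightarrow> 'n::finite form_family" where
  "Q_param \<eta> F = (\<lambda>(hbar, q). \<lambda>H\<in>Cc_inf (hbar, q).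
     (LINT X|lborel. F hbar (X, q) *
        (complex_of_real (1 / (2 * pi) ^ CARD('n)) *
          (LINT \<xi>|lborel. exp (- \<i> * complex_of_real (\<xi> \<bullet> X)) * H (hbar, \<eta> *v \<xi>, q)))))"

definition Q :: "real ^ 'n ^ 'n \<Rightarrow> ((real ^ 'n) \<times> 'n torus \<Rightarrow> complex) \<Rightarrow> 'n::finite form_family" where
  "Q \<eta> f = Q_param \<eta> (\<lambda>hbar. f)"

definition star :: "'n::finite form_family \<Rightarrow> 'n form_family \<Rightarrow> 'n form_family"
    (infixl "\<star>" 70) where
  "D \<star> E = (\<lambda>p. \<lambda>h\<in>Cc_inf p.
     E p (\<lambda>z\<in>sfibre p. D (gtarget z) (\<lambda>x\<in>sfibre (gtarget z). h (gmult x z))))"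

definition f_osc :: "int ^ 'n \<Rightarrow> (real ^ 'n) \<times> 'n torus \<Rightarrow> complex" where
  "f_osc r = (\<lambda>(X, q). torus_char r q * exp (\<i> / 2 * complex_of_real (ivec r \<bullet> X)))"

end

theory Submission
  imports Defs "HOL-Probability.Characteristic_Functions" "HOL-Probability.Sinc_Integral"
begin

text \<open>Up to the phase \<open>torus_char r q\<close>, the function \<open>f_osc r\<close> is the plane wave
\<open>X \<mapsto> exp (i \<langle>r/2, X\<rangle>)\<close>, so \<open>Q\<close> applies to \<open>\<xi> \<mapsto> H (hbar, \<eta> \<xi>, q)\<close> first the Fourier
transform and then the inverse transform at the point \<open>r/2\<close>.  Fourier inversion therefore turns
the double integral into an evaluation, \<open>Q_f_osc\<close>: \<open>Q \<eta> (f_osc r)\<close> is the point mass at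
\<open>\<eta> r/2\<close> in the fibre, weighted by \<open>torus_char r q\<close>.  The convolution of two such point masses is
again a point mass, at \<open>\<eta> r/2 + \<eta> r'/2\<close>.  The outer functional moves the base point from \<open>q\<close> to
\<open>q + hbar \<eta> r'/2\<close> before the inner weight \<open>torus_char r\<close> is read off, and this shift produces the
phase \<open>exp (i hbar/2 \<langle>r, \<eta> r'\<rangle>)\<close> (\<open>star_Q_f_osc\<close>).

The analytic content is the inversion formula for smooth compactly supported functions on a
Euclidean space (\<open>fourier_inversion\<close>).  It is needed with an absolutely convergent outer integral,
because a non-integrable function would have Lebesgue integral zero by convention.  Integrability
(\<open>fourier_integrable\<close>) comes from integration by parts: the integral of a directional derivative
of a test function vanishes, so derivatives become multiplications by coordinates and the transform
decays at least like \<open>\<Prod>b. 1 / (1 + (X \<bullet> b)\<^sup>2)\<close>.  The value is found by damping the outer integral with a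
Gaussian \<open>gauss (t X)\<close>: Fubini and the known Fourier transform of the Gaussian convert the damped
integral into a Gaussian average of \<open>f\<close> around \<open>a\<close> at scale \<open>t\<close>, and both sides converge as
\<open>t \<rightarrow> 0\<close>.

For the composition in the groupoid one also has to know that the inner functional again yields a
test function of the outer variable.  This is why closure of smoothness under affine substitution
and under multiplication by plane waves is established.\<close>

section \<open>Closure properties of smooth functions\<close>

lemma C_times_imp_differentiable: "C_times (Suc k) f \<Longrightarrow> f differentiable (at x)"
  by simp

text \<open>The clause for \<open>Suc k\<close> does not ask for continuity of the function itself, so the lowest case
rests on the fact that differentiability implies continuity.\<close>

lemma C_times_Suc_imp: "C_times (Suc k) f \<Longrightarrow> C_times k f"
proof (induction k arbitrary: f)
  case 0
  then show ?case
    by (auto intro!: differentiable_imp_continuous_on simp: differentiable_on_def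
        intro: differentiable_at_withinI)
next
  case (Suc k)
  show ?case
    unfolding C_times.simps(2)[of k]
  proof (intro conjI allI)
    fix v
    have "C_times (Suc k) (\<lambda>x. frechet_derivative f (at x) v)"
      using Suc.prems unfolding C_times.simps(2)[of "Suc k"] by blast
    then show "C_times k (\<lambda>x. frechet_derivative f (at x) v)" by (rule Suc.IH)
  qed (use Suc.prems in simp)
qed

lemma C_times_add:
  "C_times k f \<Longrightarrow> C_times k g \<Longrightarrow> C_times k (\<lambda>x. f x + g x)"
proof (induction k arbitrary: f g)
  case 0
  then show ?case by (auto intro: continuous_on_add)
next
  case (Suc k)
  have "frechet_derivative (\<lambda>x. f x + g x) (at x) v
      = frechet_derivative f (at x) v + frechet_derivative g (at x) v" for x v
  proof -
    have "((\<lambda>x. f x + g x) has_derivative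
        (\<lambda>v. frechet_derivative f (at x) v + frechet_derivative g (at x) v)) (at x)"
      using Suc.prems by (intro has_derivative_add) (auto simp: frechet_derivative_works[symmetric])
    from frechet_derivative_at[OF this] show ?thesis by metis
  qed
  then show ?case using Suc by auto
qed

lemma C_times_compose_affine:
  assumes "bounded_linear L"
  shows "C_times k f \<Longrightarrow> C_times k (\<lambda>x. f (L x + c))"
proof (induction k arbitrary: f)
  case 0
  have "continuous_on UNIV (\<lambda>x. L x + c)"
    by (intro continuous_on_add linear_continuous_on[OF assms] continuous_on_const)
  moreover have "continuous_on UNIV f" using 0 by simp
  ultimately have "continuous_on UNIV (\<lambda>x. f (L x + c))"
    using continuous_on_compose2[of UNIV f UNIV "\<lambda>x. L x + c"] by simp
  then show ?case by simp
next
  case (Suc k)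
  have D: "((\<lambda>x. f (L x + c)) has_derivative
        (\<lambda>v. frechet_derivative f (at (L x + c)) (L v))) (at x)" for x
  proof -
    have "(f has_derivative frechet_derivative f (at (L x + c))) (at (L x + c))"
      using Suc.prems by (auto simp: frechet_derivative_works[symmetric])
    moreover have "((\<lambda>x. L x + c) has_derivative L) (at x)"
      using bounded_linear_imp_has_derivative[OF assms] by (auto intro!: derivative_eq_intros)
    ultimately show ?thesis
      using diff_chain_at[of "\<lambda>x. L x + c" L x f] by (simp add: o_def)
  qed
  have "frechet_derivative (\<lambda>x. f (L x + c)) (at x) v
      = frechet_derivative f (at (L x + c)) (L v)" for x v
    using frechet_derivative_at[OF D] by metis
  moreover have "(\<lambda>x. f (L x + c)) differentiable (at x)" for x
    using D differentiable_def by blast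
  moreover have "C_times k (\<lambda>x. frechet_derivative f (at (L x + c)) (L v))" for v
    by (rule Suc.IH) (use Suc.prems in simp)
  ultimately show ?case by simp
qed

text \<open>By the Leibniz rule the derivative is again a sum of plane waves times \<open>f\<close> or a derivative of
\<open>f\<close>.  The free constant \<open>c\<close> absorbs the factor \<open>\<i> (a \<bullet> v)\<close>, which makes the induction in
\<open>C_times_times_plane_wave\<close> close up without closure under general products.\<close>

lemma has_derivative_times_plane_wave:
  fixes f :: "'a::euclidean_space \<Rightarrow> complex"
  assumes "f differentiable (at x)"
  shows "((\<lambda>x. c * exp (\<i> * complex_of_real (a \<bullet> x)) * f x) has_derivative
      (\<lambda>v. c * (\<i> * complex_of_real (a \<bullet> v)) * exp (\<i> * complex_of_real (a \<bullet> x)) * f x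
         + c * exp (\<i> * complex_of_real (a \<bullet> x)) * frechet_derivative f (at x) v)) (at x)"
proof -
  have "(f has_derivative frechet_derivative f (at x)) (at x)"
    using assms by (auto simp: frechet_derivative_works[symmetric])
  moreover have "((\<lambda>x. exp (\<i> * complex_of_real (a \<bullet> x))) has_derivative
      (\<lambda>v. \<i> * complex_of_real (a \<bullet> v) * exp (\<i> * complex_of_real (a \<bullet> x)))) (at x)"
  proof -
    have "((\<lambda>x. \<i> * complex_of_real (a \<bullet> x)) has_derivative (\<lambda>v. \<i> * complex_of_real (a \<bullet> v))) (at x)"
      by (intro bounded_linear_imp_has_derivative bounded_linear_const_mult
          bounded_linear_compose[OF bounded_linear_of_real] bounded_linear_inner_right)
    from diff_chain_at[OF this DERIV_exp[unfolded has_field_derivative_def]] show ?thesis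
      by (simp add: o_def mult_ac)
  qed
  ultimately show ?thesis
    by (auto intro!: derivative_eq_intros simp: algebra_simps)
qed

lemma C_times_times_plane_wave:
  fixes f :: "'a::euclidean_space \<Rightarrow> complex"
  shows "C_times k f \<Longrightarrow> C_times k (\<lambda>x. c * exp (\<i> * complex_of_real (a \<bullet> x)) * f x)"
proof (induction k arbitrary: f c)
  case 0
  then have "continuous_on UNIV f" by simp
  then show ?case unfolding C_times.simps(1) by (intro continuous_intros)
next
  case (Suc k)
  have "(\<lambda>x. c * exp (\<i> * complex_of_real (a \<bullet> x)) * f x) differentiable (at x)" for x
    using has_derivative_times_plane_wave C_times_imp_differentiable[OF Suc.prems]
    unfolding differentiable_def by blast
  moreover have "frechet_derivative (\<lambda>x. c * exp (\<i> * complex_of_real (a \<bullet> x)) * f x) (at x) v =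
      c * (\<i> * complex_of_real (a \<bullet> v)) * exp (\<i> * complex_of_real (a \<bullet> x)) * f x
         + c * exp (\<i> * complex_of_real (a \<bullet> x)) * frechet_derivative f (at x) v" for x v
    using frechet_derivative_at[OF has_derivative_times_plane_wave[OF C_times_imp_differentiable[OF Suc.prems]],
        symmetric, THEN fun_cong] .
  moreover have "C_times k (\<lambda>x. c * (\<i> * complex_of_real (a \<bullet> v)) * exp (\<i> * complex_of_real (a \<bullet> x)) * f x
         + c * exp (\<i> * complex_of_real (a \<bullet> x)) * frechet_derivative f (at x) v)" for v
    by (rule C_times_add; rule Suc.IH) (use Suc.prems C_times_Suc_imp[OF Suc.prems] in auto)
  ultimately show ?case by simp
qed

section \<open>Test functions\<close>

text \<open>The space \<open>C\<^sup>\<infinity>\<^sub>c\<close> on a normed space.  Boundedness of the set where \<open>f\<close> is non-zero is, in finite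
dimension, the same as compactness of its closure.\<close>

definition test_function :: "('a::real_normed_vector \<Rightarrow> complex) \<Rightarrow> bool" where
  "test_function f \<longleftrightarrow> smooth f \<and> bounded {x. f x \<noteq> 0}"

lemma test_function_differentiable: "test_function f \<Longrightarrow> f differentiable (at x)"
  unfolding test_function_def smooth_def using C_times_imp_differentiable by blast

lemma test_function_continuous: "test_function f \<Longrightarrow> continuous_on UNIV f"
  unfolding test_function_def smooth_def by (metis C_times.simps(1))

lemma test_function_support:
  assumes "test_function f"
  obtains R where "R > 0" "\<And>x. norm x \<ge> R \<Longrightarrow> f x = 0"
proof -
  obtain b where b: "b > 0" "\<And>x. x \<in> {x. f x \<noteq> 0} \<Longrightarrow> norm x \<le> b"
    using assms unfolding test_function_def bounded_pos by blast
  show ?thesis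
    by (rule that[of "b + 1"]) (use b in fastforce)+
qed

lemma test_function_bounded:
  fixes f :: "'a::euclidean_space \<Rightarrow> complex"
  assumes "test_function f"
  obtains B where "B > 0" "\<And>x. norm (f x) \<le> B"
proof -
  obtain R where R: "R > 0" "\<And>x. norm x \<ge> R \<Longrightarrow> f x = 0"
    using test_function_support[OF assms] by blast
  have "compact (f ` cball 0 R)"
    by (intro compact_continuous_image continuous_on_subset[OF test_function_continuous[OF assms]]) auto
  then obtain B where B: "B > 0" "\<And>y. y \<in> f ` cball 0 R \<Longrightarrow> norm y \<le> B"
    using compact_imp_bounded bounded_pos by metis
  have "norm (f x) \<le> B" for x
    using B R(2)[of x] by (cases "norm x \<le> R") (auto simp: less_imp_le)
  with B(1) show ?thesis using that by blast
qed

lemma test_function_integrable: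
  fixes f :: "'a::euclidean_space \<Rightarrow> complex"
  assumes "test_function f"
  shows "integrable lborel f"
proof -
  obtain R where R: "R > 0" "\<And>x. norm x \<ge> R \<Longrightarrow> f x = 0"
    using test_function_support[OF assms] by blast
  have "integrable lborel (\<lambda>x. indicator (cball 0 R) x *\<^sub>R f x)"
    by (intro borel_integrable_compact continuous_on_subset[OF test_function_continuous[OF assms]]) auto
  moreover have "(\<lambda>x. indicator (cball 0 R) x *\<^sub>R f x) = f"
    using R by (auto simp: fun_eq_iff indicator_def not_le less_imp_le)
  ultimately show ?thesis by simp
qed

lemma test_function_derivative:
  assumes "test_function f"
  shows "test_function (\<lambda>x. frechet_derivative f (at x) v)"
proof -
  obtain R where R: "R > 0" "\<And>x. norm x \<ge> R \<Longrightarrow> f x = 0"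
    using test_function_support[OF assms] by blast
  have "frechet_derivative f (at x) v = 0" if "norm x > R" for x
  proof -
    have "open {y. norm y > R}" by (intro open_Collect_less continuous_intros)
    have "(f has_derivative (\<lambda>_. 0)) (at x)"
    proof (rule has_derivative_transform_within_open)
      show "((\<lambda>_. 0) has_derivative (\<lambda>_. 0)) (at x)" by simp
    qed (use R that \<open>open {y. norm y > R}\<close> in auto)
    from frechet_derivative_at[OF this] show ?thesis by metis
  qed
  then have "bounded {x. frechet_derivative f (at x) v \<noteq> 0}"
    unfolding bounded_iff by (meson linorder_not_le mem_Collect_eq)
  moreover have "smooth (\<lambda>x. frechet_derivative f (at x) v)"
    unfolding smooth_def
  proof
    fix k
    have "C_times (Suc k) f" using assms by (simp only: test_function_def smooth_def)
    then show "C_times k (\<lambda>x. frechet_derivative f (at x) v)"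
      by (simp only: C_times.simps(2))
  qed
  ultimately show ?thesis by (simp add: test_function_def)
qed

lemma test_function_times_plane_wave:
  fixes f :: "'a::euclidean_space \<Rightarrow> complex"
  assumes "test_function f"
  shows "test_function (\<lambda>x. c * exp (\<i> * complex_of_real (a \<bullet> x)) * f x)"
proof -
  have "smooth (\<lambda>x. c * exp (\<i> * complex_of_real (a \<bullet> x)) * f x)"
    using assms C_times_times_plane_wave unfolding test_function_def smooth_def by blast
  moreover have "bounded {x. c * exp (\<i> * complex_of_real (a \<bullet> x)) * f x \<noteq> 0}"
    by (rule bounded_subset[of "{x. f x \<noteq> 0}"]) (use assms in \<open>auto simp: test_function_def\<close>)
  ultimately show ?thesis by (simp add: test_function_def)
qed

lemma test_function_translate:
  fixes f :: "'a::real_normed_vector \<Rightarrow> complex"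
  assumes "test_function f"
  shows "test_function (\<lambda>x. f (x + c))"
proof -
  have "bounded ((\<lambda>x. - c + x) ` {x. f x \<noteq> 0})"
    using assms unfolding test_function_def by (intro bounded_translation) blast
  moreover have "{x. f (x + c) \<noteq> 0} \<subseteq> (\<lambda>x. - c + x) ` {x. f x \<noteq> 0}"
  proof
    fix x assume "x \<in> {x. f (x + c) \<noteq> 0}"
    then show "x \<in> (\<lambda>x. - c + x) ` {x. f x \<noteq> 0}"
      by (intro image_eqI[of _ _ "x + c"]) auto
  qed
  ultimately have "bounded {x. f (x + c) \<noteq> 0}" by (rule bounded_subset)
  moreover have "smooth (\<lambda>x. f (x + c))"
    using assms C_times_compose_affine[OF bounded_linear_ident]
    unfolding test_function_def smooth_def by blast
  ultimately show ?thesis by (simp add: test_function_def)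
qed

text \<open>Difference quotients of \<open>f\<close> in the direction \<open>v\<close> integrate to zero by translation invariance, and
they converge boundedly, with supports in a common ball, to the directional derivative.  This
replaces an integration along lines parallel to \<open>v\<close> and needs no choice of coordinates.\<close>

lemma integral_directional_derivative_eq_0:
  fixes f :: "'a::euclidean_space \<Rightarrow> complex"
  assumes f: "test_function f"
  shows "(LINT x|lborel. frechet_derivative f (at x) v) = 0"
proof -
  let ?D = "\<lambda>x. frechet_derivative f (at x) v"
  \<comment> \<open>Steps of length at most 1 keep all difference quotients supported in one fixed ball.\<close>
  define t where "t n = inverse (real (Suc n))" for n
  define s where "s n x = (f (t n *\<^sub>R v + x) - f x) /\<^sub>R t n" for n x
  have t: "t n > 0" "t n \<le> 1" for n by (simp_all add: t_def divide_simps)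
  have tlim: "t \<longlonglongrightarrow> 0" unfolding t_def by (rule LIMSEQ_inverse_real_of_nat)
  obtain R where R: "R > 0" "\<And>x. norm x \<ge> R \<Longrightarrow> f x = 0"
    using test_function_support[OF f] by blast
  obtain B where B: "B > 0" "\<And>x. norm (?D x) \<le> B"
    using test_function_bounded[OF test_function_derivative[OF f]] by blast
  have fint: "integrable lborel f" by (rule test_function_integrable[OF f])
  have cont: "continuous_on UNIV f" by (rule test_function_continuous[OF f])
  have [measurable]: "f \<in> borel_measurable borel"
    using cont by (rule borel_measurable_continuous_onI)
  have [measurable]: "?D \<in> borel_measurable borel"
    by (rule borel_measurable_continuous_onI[OF test_function_continuous[OF test_function_derivative[OF f]]])
  have line: "((\<lambda>r. f (x + r *\<^sub>R v)) has_vector_derivative ?D (x + r *\<^sub>R v)) (at r within S)" for x r S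
  proof -
    have F: "(f has_derivative frechet_derivative f (at (x + r *\<^sub>R v))) (at (x + r *\<^sub>R v))"
      using test_function_differentiable[OF f] by (auto simp: frechet_derivative_works[symmetric])
    have "((\<lambda>r. x + r *\<^sub>R v) has_derivative (\<lambda>h. h *\<^sub>R v)) (at r)"
      by (auto intro!: derivative_eq_intros)
    from diff_chain_at[OF this F]
    have "((\<lambda>r. f (x + r *\<^sub>R v)) has_derivative
        (\<lambda>h. frechet_derivative f (at (x + r *\<^sub>R v)) (h *\<^sub>R v))) (at r)"
      by (simp add: o_def)
    moreover have "frechet_derivative f (at (x + r *\<^sub>R v)) (h *\<^sub>R v) = h *\<^sub>R ?D (x + r *\<^sub>R v)" for h
      using has_derivative_bounded_linear[OF F] by (simp add: linear_simps)
    ultimately show ?thesis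
      by (auto simp: has_vector_derivative_def intro: has_derivative_at_withinI)
  qed
  have lim: "(\<lambda>n. s n x) \<longlonglongrightarrow> ?D x" for x
  proof -
    have "((\<lambda>r. f (x + r *\<^sub>R v)) has_vector_derivative ?D x) (at 0)"
      using line[of x 0 UNIV] by simp
    then have "((\<lambda>h. norm (f (x + h *\<^sub>R v) - f x - h *\<^sub>R ?D x) / norm h) \<longlongrightarrow> 0) (at 0)"
      unfolding has_vector_derivative_def has_derivative_at by simp
    moreover have "filterlim t (at 0) sequentially"
      using tlim t(1) by (auto simp: filterlim_at less_imp_neq[symmetric])
    ultimately have "(\<lambda>n. norm (f (x + t n *\<^sub>R v) - f x - t n *\<^sub>R ?D x) / norm (t n)) \<longlonglongrightarrow> 0"
      by (rule filterlim_compose)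
    moreover have "norm (f (x + t n *\<^sub>R v) - f x - t n *\<^sub>R ?D x) / norm (t n) = norm (s n x - ?D x)" for n
    proof -
      have "s n x - ?D x = (f (x + t n *\<^sub>R v) - f x - t n *\<^sub>R ?D x) /\<^sub>R t n"
        using t(1)[of n] by (simp add: s_def scaleR_diff_right add.commute)
      then show ?thesis by (simp add: divide_inverse_commute)
    qed
    ultimately have "(\<lambda>n. norm (s n x - ?D x)) \<longlonglongrightarrow> 0" by simp
    then show ?thesis by (rule LIM_zero_cancel[OF tendsto_norm_zero_cancel])
  qed
  have bound: "norm (s n x) \<le> B * indicator (cball 0 (R + norm v)) x" for n x
  proof (cases "norm x \<le> R + norm v")
    case True
    have "norm (f (x + t n *\<^sub>R v) - f (x + 0 *\<^sub>R v)) \<le> B * norm (t n - 0)"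
    proof (rule differentiable_bound)
      show "((\<lambda>r. f (x + r *\<^sub>R v)) has_derivative (\<lambda>h. h *\<^sub>R ?D (x + r *\<^sub>R v))) (at r within UNIV)" for r
        using line[of x r UNIV] by (simp add: has_vector_derivative_def)
      show "onorm (\<lambda>h. h *\<^sub>R ?D (x + r *\<^sub>R v)) \<le> B" for r
        using B by (intro onorm_le) (simp add: mult.commute[of B] mult_left_mono)
    qed auto
    then have "norm (f (t n *\<^sub>R v + x) - f x) / t n \<le> B"
      using t(1)[of n] by (simp add: add.commute pos_divide_le_eq)
    then show ?thesis
      using True t(1)[of n] by (simp add: s_def divide_inverse_commute)
  next
    case False
    have "norm (t n *\<^sub>R v) \<le> norm v"
      using t[of n] by (simp add: mult_left_le_one_le)
    then have "norm (t n *\<^sub>R v + x) \<ge> R"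
      using False norm_triangle_ineq4[of "t n *\<^sub>R v + x" "t n *\<^sub>R v"] by simp
    moreover have "norm x \<ge> R" using False norm_ge_zero[of v] by linarith
    ultimately show ?thesis using R(2) B(1) by (simp add: s_def indicator_def)
  qed
  have "(\<lambda>n. LINT x|lborel. s n x) \<longlonglongrightarrow> (LINT x|lborel. ?D x)"
  proof (rule integral_dominated_convergence)
    show "integrable lborel (\<lambda>x::'a. B * indicator (cball 0 (R + norm v)) x)"
      by (intro integrable_mult_right integrable_real_indicator)
        (use emeasure_bounded_finite[OF bounded_cball, of "0::'a" "R + norm v"] in \<open>auto simp: infinity_ennreal_def\<close>)
  qed (use lim bound in \<open>auto simp: s_def\<close>)
  \<comment> \<open>Translation invariance of the Lebesgue measure.\<close>
  moreover have "(LINT x|lborel. s n x) = 0" for n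
  proof -
    have "integrable (distr lborel borel ((+) (t n *\<^sub>R v))) f"
      using fint by (simp add: lborel_distr_plus)
    then have i: "integrable lborel (\<lambda>x. f (t n *\<^sub>R v + x))"
      by (subst (asm) integrable_distr_eq) auto
    have "(LINT x|lborel. f (t n *\<^sub>R v + x)) = (LINT x|distr lborel borel ((+) (t n *\<^sub>R v)). f x)"
      by (subst integral_distr) auto
    also have "\<dots> = (LINT x|lborel. f x)" by (simp add: lborel_distr_plus)
    finally show ?thesis using i fint by (simp add: s_def)
  qed
  ultimately show ?thesis by (simp add: LIMSEQ_const_iff)
qed

section \<open>Lebesgue integrals of products and of Gaussians\<close>

text \<open>The Lebesgue measure of a Euclidean space is the image of the product of the Lebesgue measures on
the coordinate axes, so the integral of a product of one-variable functions factors.\<close>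

lemma
  fixes f :: "'a::euclidean_space \<Rightarrow> real \<Rightarrow> complex"
  assumes f: "\<And>b. b \<in> Basis \<Longrightarrow> integrable lborel (f b)"
  shows integrable_lborel_prod: "integrable lborel (\<lambda>x::'a. \<Prod>b\<in>Basis. f b (x \<bullet> b))"
    and integral_lborel_prod:
      "(LINT x|lborel. (\<Prod>b\<in>Basis. f b (x \<bullet> b))) = (\<Prod>b\<in>Basis. (LINT y|lborel. f b y))"
proof -
  interpret product_sigma_finite "\<lambda>_::'a. lborel :: real measure" ..
  have [measurable]: "f b \<in> borel_measurable borel" if "b \<in> Basis" for b
    using f[OF that] by simp
  have [measurable]: "(\<lambda>x::'a. \<Prod>b\<in>Basis. f b (x \<bullet> b)) \<in> borel_measurable borel"
    by measurable
  have [measurable]: "(\<lambda>y. \<Sum>b\<in>Basis. y b *\<^sub>R b) \<in> borel_measurable (\<Pi>\<^sub>M b\<in>(Basis :: 'a set). lborel)"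
    by (intro borel_measurable_sum borel_measurable_scaleR) simp_all
  have eq: "(\<Prod>b\<in>Basis. f b ((\<Sum>b\<in>Basis. y b *\<^sub>R b) \<bullet> b)) = (\<Prod>b\<in>Basis. f b (y b))" for y
    by (intro prod.cong) auto
  show "integrable lborel (\<lambda>x::'a. \<Prod>b\<in>Basis. f b (x \<bullet> b))"
    by (subst lborel_eq[where 'a='a], subst integrable_distr_eq)
      (simp_all only: eq product_integrable_prod f finite_Basis, measurable)
  show "(LINT x|lborel. (\<Prod>b\<in>Basis. f b (x \<bullet> b))) = (\<Prod>b\<in>Basis. (LINT y|lborel. f b y))"
    by (subst lborel_eq[where 'a='a], subst integral_distr)
      (simp_all only: eq product_integral_prod f finite_Basis, measurable)
qed

text \<open>The substitution \<open>x \<mapsto> a + c x\<close>; it serves both the scaling of the Gaussian and the recentring of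
the average of \<open>f\<close> at the point of inversion.\<close>

lemma
  fixes g :: "'a::euclidean_space \<Rightarrow> complex" and c :: real
  assumes g: "integrable lborel g" and c: "c > 0"
  shows integrable_lborel_affine: "integrable lborel (\<lambda>x. g (a + c *\<^sub>R x))"
    and integral_lborel_affine:
      "(LINT x|lborel. g x) = c ^ DIM('a) *\<^sub>R (LINT x|lborel. g (a + c *\<^sub>R x))"
proof -
  have [measurable]: "g \<in> borel_measurable borel" using g by simp
  have eq: "(lborel :: 'a measure)
      = density (distr lborel borel (\<lambda>x. a + c *\<^sub>R x)) (\<lambda>_. ennreal (c ^ DIM('a)))"
    using lborel_affine[of c a] c by simp
  have "integrable (density (distr lborel borel (\<lambda>x. a + c *\<^sub>R x)) (\<lambda>_. ennreal (c ^ DIM('a)))) g"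
    using g unfolding eq[symmetric] .
  then have "integrable lborel (\<lambda>x. c ^ DIM('a) *\<^sub>R g (a + c *\<^sub>R x))"
    using c by (subst (asm) integrable_density) (auto simp: integrable_distr_eq)
  then have "integrable lborel (\<lambda>x. inverse (c ^ DIM('a)) *\<^sub>R c ^ DIM('a) *\<^sub>R g (a + c *\<^sub>R x))"
    by (rule integrable_scaleR_right)
  then show "integrable lborel (\<lambda>x. g (a + c *\<^sub>R x))" using c by simp
  have "(LINT x|lborel. g x) = (LINT x|density (distr lborel borel (\<lambda>x. a + c *\<^sub>R x)) (\<lambda>_. ennreal (c ^ DIM('a))). g x)"
    unfolding eq[symmetric] ..
  also have "\<dots> = c ^ DIM('a) *\<^sub>R (LINT x|lborel. g (a + c *\<^sub>R x))"
    using c by (subst integral_density) (auto simp: integral_distr)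
  finally show "(LINT x|lborel. g x) = c ^ DIM('a) *\<^sub>R (LINT x|lborel. g (a + c *\<^sub>R x))" .
qed

definition gauss :: "'a::euclidean_space \<Rightarrow> real" where
  "gauss x = exp (- (x \<bullet> x) / 2)"

lemma gauss_prod: "gauss x = (\<Prod>b\<in>Basis. exp (- (x \<bullet> b)\<^sup>2 / 2))"
  unfolding gauss_def
  by (subst euclidean_inner)
    (simp add: exp_sum[symmetric] power2_eq_square sum_negf sum_divide_distrib)

text \<open>This is the characteristic function of the standard normal distribution, with the normalising
factor \<open>sqrt (2 * pi)\<close> of its density cleared.\<close>

lemma
  fixes t :: real
  shows integrable_iexp_gauss_real: "integrable lborel (\<lambda>x. iexp (t * x) * complex_of_real (exp (- x\<^sup>2 / 2)))"
    and integral_iexp_gauss_real: "(LINT x|lborel. iexp (t * x) * complex_of_real (exp (- x\<^sup>2 / 2)))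
        = complex_of_real (sqrt (2 * pi) * exp (- t\<^sup>2 / 2))"
proof -
  have eq: "iexp (t * x) * complex_of_real (exp (- x\<^sup>2 / 2))
      = sqrt (2 * pi) * (std_normal_density x *\<^sub>R iexp (t * x))" for x
    by (simp add: std_normal_density_def scaleR_conv_of_real field_simps)
  have "integrable std_normal_distribution (\<lambda>x. iexp (t * x))"
    by (rule prob_space.integrable_iexp[OF prob_space_normal_density]) auto
  then have i: "integrable lborel (\<lambda>x. std_normal_density x *\<^sub>R iexp (t * x))"
    by (subst (asm) integrable_density) auto
  then show "integrable lborel (\<lambda>x. iexp (t * x) * complex_of_real (exp (- x\<^sup>2 / 2)))"
    unfolding eq by (rule integrable_mult_right)
  have "(LINT x|lborel. std_normal_density x *\<^sub>R iexp (t * x)) = char std_normal_distribution t"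
    unfolding char_def by (subst integral_density) auto
  then show "(LINT x|lborel. iexp (t * x) * complex_of_real (exp (- x\<^sup>2 / 2)))
        = complex_of_real (sqrt (2 * pi) * exp (- t\<^sup>2 / 2))"
    unfolding eq integral_mult_right_zero by (simp add: char_std_normal_distribution)
qed

lemma iexp_inner_prod: "iexp (y \<bullet> x) = (\<Prod>b\<in>Basis. iexp ((y \<bullet> b) * (x \<bullet> b)))"
  by (subst euclidean_inner) (simp add: exp_sum[symmetric] sum_distrib_left)

text \<open>The Gaussian and the plane wave both factor over an orthonormal basis, so the one-dimensional
transform gives the general one.\<close>

lemma
  fixes y :: "'a::euclidean_space"
  shows integrable_iexp_gauss: "integrable lborel (\<lambda>x. iexp (y \<bullet> x) * complex_of_real (gauss x))"
    and integral_iexp_gauss: "(LINT x|lborel. iexp (y \<bullet> x) * complex_of_real (gauss x))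
        = complex_of_real (sqrt (2 * pi) ^ DIM('a) * gauss y)"
proof -
  have eq: "iexp (y \<bullet> x) * complex_of_real (gauss x)
      = (\<Prod>b\<in>Basis. iexp ((y \<bullet> b) * (x \<bullet> b)) * complex_of_real (exp (- (x \<bullet> b)\<^sup>2 / 2)))" for x
    by (simp only: iexp_inner_prod gauss_prod prod.distrib of_real_prod)
  show "integrable lborel (\<lambda>x. iexp (y \<bullet> x) * complex_of_real (gauss x))"
    unfolding eq by (intro integrable_lborel_prod integrable_iexp_gauss_real)
  show "(LINT x|lborel. iexp (y \<bullet> x) * complex_of_real (gauss x))
        = complex_of_real (sqrt (2 * pi) ^ DIM('a) * gauss y)"
    unfolding eq 
    by (subst integral_lborel_prod[OF integrable_iexp_gauss_real])
       (simp only: integral_iexp_gauss_real of_real_prod[symmetric] prod.distrib prod_constant gauss_prod)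
qed

section \<open>Decay of the Fourier transform\<close>

definition fourier :: "('a::euclidean_space \<Rightarrow> complex) \<Rightarrow> 'a \<Rightarrow> complex" where
  "fourier f X = (LINT \<xi>|lborel. exp (- \<i> * complex_of_real (\<xi> \<bullet> X)) * f \<xi>)"

text \<open>The form \<open>c * iexp (a \<bullet> x) * f x\<close>, here with \<open>c = 1\<close>, is the one in which test functions are known
to be closed under multiplication by plane waves.\<close>

lemma fourier_plane_wave: "exp (- \<i> * complex_of_real (\<xi> \<bullet> X)) * f \<xi> = 1 * iexp ((- X) \<bullet> \<xi>) * f \<xi>"
  by (simp add: inner_commute)

lemma fourier_measurable [measurable]:
  assumes [measurable]: "f \<in> borel_measurable borel"
  shows "fourier f \<in> borel_measurable borel"
  unfolding fourier_def by measurable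

lemma test_function_measurable: "test_function f \<Longrightarrow> f \<in> borel_measurable borel"
  by (intro borel_measurable_continuous_onI test_function_continuous)

lemma fourier_bounded:
  assumes "test_function f"
  shows "norm (fourier f X) \<le> (LINT \<xi>|lborel. norm (f \<xi>))"
proof -
  have "norm (fourier f X) \<le> (LINT \<xi>|lborel. norm (exp (- \<i> * complex_of_real (\<xi> \<bullet> X)) * f \<xi>))"
    unfolding fourier_def by (rule integral_norm_bound)
  then show ?thesis by (simp add: norm_mult)
qed

text \<open>Integration by parts: the directional derivative of \<open>x \<mapsto> exp (- \<i> (x \<bullet> X)) f x\<close> has integral
zero, and the Leibniz rule splits it into the two transforms that are compared.\<close>

lemma fourier_directional_derivative:
  assumes f: "test_function f"
  shows "fourier (\<lambda>x. frechet_derivative f (at x) v) X = \<i> * complex_of_real (v \<bullet> X) * fourier f X"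
proof -
  let ?e = "\<lambda>x. 1 * iexp ((- X) \<bullet> x)"
  have "(LINT x|lborel. frechet_derivative (\<lambda>x. ?e x * f x) (at x) v) = 0"
    by (intro integral_directional_derivative_eq_0 test_function_times_plane_wave f)
  moreover have "frechet_derivative (\<lambda>x. ?e x * f x) (at x) v =
      - \<i> * complex_of_real (v \<bullet> X) * (?e x * f x) + ?e x * frechet_derivative f (at x) v" for x
    using frechet_derivative_at[OF has_derivative_times_plane_wave[OF test_function_differentiable[OF f],
        of 1 "- X"], symmetric, THEN fun_cong]
    by (simp add: inner_commute)
  moreover have "integrable lborel (\<lambda>x. ?e x * f x)"
    by (intro test_function_integrable test_function_times_plane_wave f)
  moreover have "integrable lborel (\<lambda>x. ?e x * frechet_derivative f (at x) v)"
    by (intro test_function_integrable test_function_times_plane_wave test_function_derivative f)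
  ultimately have "- \<i> * complex_of_real (v \<bullet> X) * (LINT x|lborel. ?e x * f x)
      + (LINT x|lborel. ?e x * frechet_derivative f (at x) v) = 0"
    by (simp only: Bochner_Integration.integral_add integrable_mult_right integral_mult_right_zero)
  then show ?thesis
    unfolding fourier_def fourier_plane_wave by (simp only: add_eq_0_iff) (simp add: inner_commute)
qed

text \<open>Each direction is treated with the second derivative along it, whose transform is
\<open>- (X \<bullet> b)\<^sup>2\<close> times the transform of \<open>f\<close>: a bound for both gives a bound with the extra factor
\<open>1 + (X \<bullet> b)\<^sup>2\<close>.  The induction is over all test functions at once since it passes from \<open>f\<close>
to its derivatives.\<close>

lemma fourier_decay:
  fixes f :: "'a::euclidean_space \<Rightarrow> complex"
  assumes "finite S" "test_function f"
  shows "\<exists>C. \<forall>X. (\<Prod>b\<in>S. 1 + (X \<bullet> b)\<^sup>2) * norm (fourier f X) \<le> C"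
  using assms
proof (induction S arbitrary: f rule: finite_induct)
  case empty
  then show ?case using fourier_bounded by auto
next
  case (insert b S)
  define g where "g = (\<lambda>x. frechet_derivative (\<lambda>x. frechet_derivative f (at x) b) (at x) b)"
  have g: "test_function g"
    unfolding g_def by (intro test_function_derivative insert.prems)
  have *: "norm (fourier g X) = (X \<bullet> b)\<^sup>2 * norm (fourier f X)" for X
    unfolding g_def
    by (simp add: fourier_directional_derivative test_function_derivative insert.prems
        norm_mult power2_eq_square inner_commute flip: abs_mult)
  obtain C1 where C1: "\<And>X. (\<Prod>b\<in>S. 1 + (X \<bullet> b)\<^sup>2) * norm (fourier f X) \<le> C1"
    using insert.IH[OF insert.prems] by blast
  obtain C2 where C2: "\<And>X. (\<Prod>b\<in>S. 1 + (X \<bullet> b)\<^sup>2) * norm (fourier g X) \<le> C2"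
    using insert.IH[OF g] by blast
  have "(\<Prod>b\<in>insert b S. 1 + (X \<bullet> b)\<^sup>2) * norm (fourier f X) \<le> C1 + C2" for X
  proof -
    have "(\<Prod>b\<in>insert b S. 1 + (X \<bullet> b)\<^sup>2) * norm (fourier f X)
      = (\<Prod>b\<in>S. 1 + (X \<bullet> b)\<^sup>2) * norm (fourier f X) + (\<Prod>b\<in>S. 1 + (X \<bullet> b)\<^sup>2) * norm (fourier g X)"
      using insert.hyps by (simp add: * algebra_simps)
    then show ?thesis using C1[of X] C2[of X] by linarith
  qed
  then show ?case by blast
qed

text \<open>Taking all basis directions in \<open>fourier_decay\<close> dominates the transform by a product of integrable
functions \<open>x \<mapsto> 1 / (1 + x\<^sup>2)\<close> of the coordinates.\<close>

lemma fourier_integrable: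
  fixes f :: "'a::euclidean_space \<Rightarrow> complex"
  assumes f: "test_function f"
  shows "integrable lborel (fourier f)"
proof -
  obtain C where C: "\<And>X. (\<Prod>b\<in>Basis. 1 + (X \<bullet> b)\<^sup>2) * norm (fourier f X) \<le> C"
    using fourier_decay[OF finite_Basis f] by blast
  have [measurable]: "f \<in> borel_measurable borel" by (rule test_function_measurable[OF f])
  have "integrable lborel (\<lambda>x::real. complex_of_real (inverse (1 + x\<^sup>2)))"
    using integrable_inverse_1_plus_square unfolding set_integrable_def
    by (intro integrable_of_real) simp
  then have "integrable lborel (\<lambda>X::'a. \<Prod>b\<in>Basis. complex_of_real (inverse (1 + (X \<bullet> b)\<^sup>2)))"
    by (intro integrable_lborel_prod)
  then have "integrable lborel (\<lambda>X::'a. complex_of_real C * (\<Prod>b\<in>Basis. complex_of_real (inverse (1 + (X \<bullet> b)\<^sup>2))))"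
    by simp
  then show ?thesis
  proof (rule Bochner_Integration.integrable_bound)
    have "norm (fourier f X) \<le> norm (complex_of_real C * (\<Prod>b\<in>Basis. complex_of_real (inverse (1 + (X \<bullet> b)\<^sup>2))))" for X
    proof -
      have p: "(\<Prod>b\<in>Basis. 1 + (X \<bullet> b)\<^sup>2) > 0"
        by (intro prod_pos ballI add_pos_nonneg) auto
      have "norm (fourier f X) \<le> C * inverse (\<Prod>b\<in>Basis. 1 + (X \<bullet> b)\<^sup>2)"
        using C[of X] p by (simp add: field_simps)
      also have "\<dots> = C * (\<Prod>b\<in>Basis. inverse (1 + (X \<bullet> b)\<^sup>2))"
        by (simp add: prod_inversef[symmetric] o_def)
      finally show ?thesis
        unfolding of_real_prod[symmetric] of_real_mult[symmetric] norm_of_real by linarith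
    qed
    then show "AE X in lborel. norm (fourier f X) \<le> norm (complex_of_real C * (\<Prod>b\<in>Basis. complex_of_real (inverse (1 + (X \<bullet> b)\<^sup>2))))"
      by simp
  qed simp
qed

section \<open>Fourier inversion\<close>

lemma gauss_measurable [measurable]: "gauss \<in> borel_measurable borel"
  unfolding gauss_def by measurable

lemma gauss_bounds: "0 \<le> gauss x" "gauss x \<le> 1"
  by (simp_all add: gauss_def)

lemma integrable_gauss: "integrable lborel (\<lambda>x::'a::euclidean_space. complex_of_real (gauss x))"
  using integrable_iexp_gauss[of "0::'a"] by simp

lemma
  fixes y :: "'a::euclidean_space"
  assumes t: "t > 0"
  shows integrable_scaled_gauss: "integrable lborel (\<lambda>x::'a. complex_of_real (gauss (t *\<^sub>R x)))"
    and integral_iexp_scaled_gauss: "(LINT x|lborel. iexp (y \<bullet> x) * complex_of_real (gauss (t *\<^sub>R x)))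
      = complex_of_real (inverse (t ^ DIM('a)) * sqrt (2 * pi) ^ DIM('a) * gauss (y /\<^sub>R t))"
proof -
  show i: "integrable lborel (\<lambda>x::'a. complex_of_real (gauss (t *\<^sub>R x)))"
    using integrable_lborel_affine[OF integrable_gauss t, of 0] by simp
  have "integrable lborel (\<lambda>x. iexp (y \<bullet> x) * complex_of_real (gauss (t *\<^sub>R x)))"
    by (rule Bochner_Integration.integrable_bound[OF i]) (auto simp: norm_mult)
  then have "(LINT x|lborel. iexp (y \<bullet> x) * complex_of_real (gauss (t *\<^sub>R x)))
    = inverse t ^ DIM('a) *\<^sub>R (LINT x|lborel. iexp (y \<bullet> (0 + inverse t *\<^sub>R x))
        * complex_of_real (gauss (t *\<^sub>R (0 + inverse t *\<^sub>R x))))"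
    using t by (intro integral_lborel_affine) auto
  also have "\<dots> = inverse t ^ DIM('a) *\<^sub>R (LINT x|lborel. iexp ((y /\<^sub>R t) \<bullet> x) * complex_of_real (gauss x))"
    using t by simp
  finally show "(LINT x|lborel. iexp (y \<bullet> x) * complex_of_real (gauss (t *\<^sub>R x)))
      = complex_of_real (inverse (t ^ DIM('a)) * sqrt (2 * pi) ^ DIM('a) * gauss (y /\<^sub>R t))"
    by (simp only: integral_iexp_gauss scaleR_conv_of_real of_real_mult power_inverse mult.assoc)
qed

text \<open>The Gaussian factor makes the double integral absolutely convergent, so the order of integration
may be exchanged.  The inner integral is then the transform of a scaled Gaussian, concentrated at
\<open>a\<close> on the scale \<open>t\<close>, and the substitution \<open>\<xi> = a + t y\<close> makes the powers of \<open>t\<close> cancel.\<close>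

lemma fourier_inversion_regularised:
  fixes f :: "'a::euclidean_space \<Rightarrow> complex"
  assumes f: "test_function f" and t: "t > 0"
  shows "(LINT X|lborel. iexp (a \<bullet> X) * fourier f X * complex_of_real (gauss (t *\<^sub>R X)))
    = complex_of_real (sqrt (2 * pi) ^ DIM('a)) * (LINT y|lborel. f (a + t *\<^sub>R y) * complex_of_real (gauss y))"
proof -
  have [measurable]: "f \<in> borel_measurable borel" by (rule test_function_measurable[OF f])
  have fint: "integrable lborel f" by (rule test_function_integrable[OF f])
  define F where "F = (\<lambda>X \<xi>. f \<xi> * (iexp ((a - \<xi>) \<bullet> X) * complex_of_real (gauss (t *\<^sub>R X))))"
  have Fmeas [measurable]: "case_prod F \<in> borel_measurable (lborel \<Otimes>\<^sub>M lborel)"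
    unfolding F_def case_prod_unfold by measurable
  have normF: "norm (F X \<xi>) = norm (f \<xi>) * gauss (t *\<^sub>R X)" for X \<xi>
    by (simp add: F_def norm_mult gauss_bounds)
  have Fint: "integrable (lborel \<Otimes>\<^sub>M lborel) (case_prod F)"
  proof (rule lborel_pair.Fubini_integrable)
    have "integrable lborel (\<lambda>X::'a. (LINT \<xi>|lborel. norm (f \<xi>)) * norm (complex_of_real (gauss (t *\<^sub>R X))))"
      by (intro integrable_mult_right integrable_norm integrable_scaled_gauss t)
    then show "integrable lborel (\<lambda>X. LINT \<xi>|lborel. norm (case_prod F (X, \<xi>)))"
      by (simp add: normF gauss_bounds)
    have "integrable lborel (F X)" for X
    proof (rule Bochner_Integration.integrable_bound[OF integrable_mult_left[OF integrable_norm[OF fint]]])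
      show "F X \<in> borel_measurable lborel" unfolding F_def by measurable
      show "AE \<xi> in lborel. norm (F X \<xi>) \<le> norm (norm (f \<xi>) * gauss (t *\<^sub>R X))"
        by (simp add: normF)
    qed
    then show "AE X in lborel. integrable lborel (\<lambda>\<xi>. case_prod F (X, \<xi>))" by simp
  qed measurable
  have "(LINT X|lborel. iexp (a \<bullet> X) * fourier f X * complex_of_real (gauss (t *\<^sub>R X)))
    = (LINT X|lborel. LINT \<xi>|lborel. F X \<xi>)"
  proof (rule Bochner_Integration.integral_cong[OF refl])
    fix X :: 'a
    have "F X \<xi> = iexp (a \<bullet> X) * complex_of_real (gauss (t *\<^sub>R X)) *
        (exp (- \<i> * complex_of_real (\<xi> \<bullet> X)) * f \<xi>)" for \<xi>
      by (simp add: F_def inner_diff_left right_diff_distrib exp_diff exp_minus field_simps)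
    then show "iexp (a \<bullet> X) * fourier f X * complex_of_real (gauss (t *\<^sub>R X)) = (LINT \<xi>|lborel. F X \<xi>)"
      unfolding fourier_def by (simp only: integral_mult_right_zero) (simp only: mult_ac)
  qed
  also have "\<dots> = (LINT \<xi>|lborel. LINT X|lborel. F X \<xi>)"
    by (rule lborel_pair.Fubini_integral[OF Fint, symmetric])
  also have "\<dots> = (LINT \<xi>|lborel. f \<xi> *
      complex_of_real (inverse (t ^ DIM('a)) * sqrt (2 * pi) ^ DIM('a) * gauss ((a - \<xi>) /\<^sub>R t)))"
    by (simp only: F_def integral_mult_right_zero integral_iexp_scaled_gauss[OF t])
  also have "\<dots> = complex_of_real (inverse (t ^ DIM('a)) * sqrt (2 * pi) ^ DIM('a)) *
      (LINT \<xi>|lborel. f \<xi> * complex_of_real (gauss ((a - \<xi>) /\<^sub>R t)))"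
    by (subst integral_mult_right_zero[symmetric]) (simp add: mult_ac)
  also have "(LINT \<xi>|lborel. f \<xi> * complex_of_real (gauss ((a - \<xi>) /\<^sub>R t)))
     = t ^ DIM('a) *\<^sub>R (LINT y|lborel. f (a + t *\<^sub>R y) * complex_of_real (gauss ((a - (a + t *\<^sub>R y)) /\<^sub>R t)))"
  proof (rule integral_lborel_affine[OF _ t])
    show "integrable lborel (\<lambda>\<xi>. f \<xi> * complex_of_real (gauss ((a - \<xi>) /\<^sub>R t)))"
      by (rule Bochner_Integration.integrable_bound[OF fint])
        (auto simp: norm_mult gauss_bounds mult_left_le)
  qed
  also have "(\<lambda>y. gauss ((a - (a + t *\<^sub>R y)) /\<^sub>R t)) = gauss"
    using t by (auto simp: gauss_def)
  finally show ?thesis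
    using t by (simp add: scaleR_conv_of_real)
qed

text \<open>The limit \<open>t \<rightarrow> 0\<close> of the regularised formula.  On the left the integrable transform itself is
a dominating function; on the right it is a multiple of the Gaussian.  One factor
\<open>sqrt (2 * pi) ^ DIM('a)\<close> comes from the transform of the Gaussian and a second one from its total
mass, whence the constant \<open>(2 * pi) ^ DIM('a)\<close>.\<close>

theorem fourier_inversion:
  fixes f :: "'a::euclidean_space \<Rightarrow> complex"
  assumes f: "test_function f"
  shows "(LINT X|lborel. iexp (a \<bullet> X) * (complex_of_real (1 / (2 * pi) ^ DIM('a)) * fourier f X)) = f a"
proof -
  let ?c = "complex_of_real (sqrt (2 * pi) ^ DIM('a))"
  define t where "t n = inverse (real (Suc n))" for n
  have t: "t n > 0" for n by (simp add: t_def)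
  have tlim: "t \<longlonglongrightarrow> 0" unfolding t_def by (rule LIMSEQ_inverse_real_of_nat)
  have [measurable]: "f \<in> borel_measurable borel" by (rule test_function_measurable[OF f])
  obtain B where B: "B > 0" "\<And>x. norm (f x) \<le> B" using test_function_bounded[OF f] by blast
  have "(\<lambda>n. LINT X|lborel. iexp (a \<bullet> X) * fourier f X * complex_of_real (gauss (t n *\<^sub>R X)))
      \<longlonglongrightarrow> (LINT X|lborel. iexp (a \<bullet> X) * fourier f X)"
  proof (rule integral_dominated_convergence)
    show "integrable lborel (\<lambda>X. norm (fourier f X))"
      by (intro integrable_norm fourier_integrable f)
    have "(\<lambda>n. iexp (a \<bullet> X) * fourier f X * complex_of_real (gauss (t n *\<^sub>R X)))
        \<longlonglongrightarrow> iexp (a \<bullet> X) * fourier f X * complex_of_real (exp (- ((0 *\<^sub>R X) \<bullet> (0 *\<^sub>R X)) / 2))" for X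
      unfolding gauss_def by (intro tendsto_intros tlim) simp
    then show "AE X in lborel. (\<lambda>n. iexp (a \<bullet> X) * fourier f X * complex_of_real (gauss (t n *\<^sub>R X)))
        \<longlonglongrightarrow> iexp (a \<bullet> X) * fourier f X" by simp
    show "AE X in lborel. norm (iexp (a \<bullet> X) * fourier f X * complex_of_real (gauss (t n *\<^sub>R X)))
        \<le> norm (fourier f X)" for n
      by (simp add: norm_mult gauss_bounds mult_left_le)
  qed measurable
  moreover have "(\<lambda>n. LINT X|lborel. iexp (a \<bullet> X) * fourier f X * complex_of_real (gauss (t n *\<^sub>R X)))
      \<longlonglongrightarrow> ?c * (LINT y|lborel. f a * complex_of_real (gauss (y::'a)))"
    unfolding fourier_inversion_regularised[OF f t]
  proof (rule tendsto_mult_left, rule integral_dominated_convergence)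
    show "integrable lborel (\<lambda>y::'a. B * norm (complex_of_real (gauss y)))"
      by (intro integrable_mult_right integrable_norm integrable_gauss)
    have "isCont f a"
      using test_function_continuous[OF f] by (simp add: continuous_on_eq_continuous_at)
    moreover have "(\<lambda>n. a + t n *\<^sub>R y) \<longlonglongrightarrow> a" for y
      using tendsto_add[OF tendsto_const tendsto_scaleR[OF tlim tendsto_const], of a y] by simp
    ultimately have "(\<lambda>n. f (a + t n *\<^sub>R y)) \<longlonglongrightarrow> f a" for y
      by (rule isCont_tendsto_compose)
    then show "AE y in lborel. (\<lambda>n. f (a + t n *\<^sub>R y) * complex_of_real (gauss y)) \<longlonglongrightarrow> f a * complex_of_real (gauss y)"
      by (intro always_eventually allI tendsto_mult tendsto_const)
    show "AE y in lborel. norm (f (a + t n *\<^sub>R y) * complex_of_real (gauss y)) \<le> B * norm (complex_of_real (gauss y))" for n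
      using B by (simp add: norm_mult mult_right_mono)
  qed measurable
  ultimately have "(LINT X|lborel. iexp (a \<bullet> X) * fourier f X) = ?c * (LINT y|lborel. f a * complex_of_real (gauss (y::'a)))"
    by (rule LIMSEQ_unique)
  also have "(LINT y|lborel. f a * complex_of_real (gauss (y::'a))) = f a * ?c"
    using integral_iexp_gauss[of "0::'a"] by (simp add: gauss_def)
  also have "?c * (f a * ?c) = (?c * ?c) * f a"
    by (simp only: mult_ac)
  also have "?c * ?c = complex_of_real ((2 * pi) ^ DIM('a))"
    unfolding of_real_mult[symmetric] power_mult_distrib[symmetric] by simp
  finally have "(LINT X|lborel. iexp (a \<bullet> X) * fourier f X) = complex_of_real ((2 * pi) ^ DIM('a)) * f a" .
  moreover have "(LINT X|lborel. iexp (a \<bullet> X) * (complex_of_real (1 / (2 * pi) ^ DIM('a)) * fourier f X))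
      = complex_of_real (1 / (2 * pi) ^ DIM('a)) * (LINT X|lborel. iexp (a \<bullet> X) * fourier f X)"
    by (subst integral_mult_right_zero[symmetric]) (simp only: mult_ac)
  ultimately show ?thesis by simp
qed

section \<open>The convolution of the quantised plane waves\<close>

lemma sfibre_iff [simp]: "(hbar', u, q') \<in> sfibre (hbar, q) \<longleftrightarrow> hbar' = hbar \<and> q' = q"
  by (auto simp: sfibre_def)

lemma Cc_inf_iff:
  "h \<in> Cc_inf (hbar, q) \<longleftrightarrow> h \<in> extensional (sfibre (hbar, q)) \<and> test_function (\<lambda>u. h (hbar, u, q))"
  by (simp add: Cc_inf_def test_function_def)

lemma restrict_sfibre_in_Cc_inf:
  "(\<lambda>z\<in>sfibre (hbar, q). k z) \<in> Cc_inf (hbar, q) \<longleftrightarrow> test_function (\<lambda>u. k (hbar, u, q))"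
  by (simp add: Cc_inf_iff)

text \<open>Invertibility is what keeps the support bounded: it is the image of the support of \<open>f\<close> under the
inverse matrix.\<close>

lemma test_function_compose_invertible:
  fixes f :: "real ^ 'n \<Rightarrow> complex" and A :: "real ^ 'n ^ ('n::finite)"
  assumes f: "test_function f" and A: "invertible A"
  shows "test_function (\<lambda>x. f (A *v x))"
proof -
  obtain B where B: "B ** A = mat 1" using A by (auto simp: invertible_def)
  have "C_times k (\<lambda>x. f (A *v x + 0))" for k
    by (rule C_times_compose_affine[OF matrix_vector_mul_bounded_linear])
      (use f in \<open>simp only: test_function_def smooth_def\<close>)
  then have "smooth (\<lambda>x. f (A *v x))" by (simp add: smooth_def)
  moreover have "bounded ((\<lambda>y. B *v y) ` {y. f y \<noteq> 0})"
    using f unfolding test_function_def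
    by (intro bounded_linear_image matrix_vector_mul_bounded_linear) blast
  moreover have "{x. f (A *v x) \<noteq> 0} \<subseteq> (\<lambda>y. B *v y) ` {y. f y \<noteq> 0}"
  proof
    fix x assume "x \<in> {x. f (A *v x) \<noteq> 0}"
    then show "x \<in> (\<lambda>y. B *v y) ` {y. f y \<noteq> 0}"
      by (intro image_eqI[of _ _ "A *v x"]) (simp_all add: matrix_vector_mul_assoc B)
  qed
  ultimately show ?thesis
    unfolding test_function_def using bounded_subset by blast
qed

text \<open>Fourier inversion at the point \<open>r/2\<close> collapses the oscillating integral to a point evaluation.\<close>

lemma Q_f_osc:
  fixes \<eta> :: "real ^ 'n ^ ('n::finite)"
  assumes inv: "invertible \<eta>" and h: "h \<in> Cc_inf (hbar, q)"
  shows "Q \<eta> (f_osc r) (hbar, q) h = torus_char r q * h (hbar, \<eta> *v (ivec r /\<^sub>R 2), q)"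
proof -
  define \<phi> where "\<phi> \<xi> = h (hbar, \<eta> *v \<xi>, q)" for \<xi>
  have \<phi>: "test_function \<phi>"
    using h unfolding \<phi>_def Cc_inf_iff by (intro test_function_compose_invertible[OF _ inv]) simp
  have "Q \<eta> (f_osc r) (hbar, q) h = (LINT X|lborel. torus_char r q *
      (iexp ((ivec r /\<^sub>R 2) \<bullet> X) * (complex_of_real (1 / (2 * pi) ^ DIM(real ^ 'n)) * fourier \<phi> X)))"
    using h by (simp add: Q_def Q_param_def f_osc_def fourier_def \<phi>_def mult_ac)
  also have "\<dots> = torus_char r q * \<phi> (ivec r /\<^sub>R 2)"
    by (simp only: integral_mult_right_zero fourier_inversion[OF \<phi>])
  finally show ?thesis by (simp add: \<phi>_def)
qed

lemma torus_char_shift: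
  "torus_char r (torus_shift q u) = torus_char r q * iexp (ivec r \<bullet> u)"
  by transfer (simp add: inner_add_right exp_add[symmetric] algebra_simps)

lemma torus_char_add: "torus_char (r + r') q = torus_char r q * torus_char r' q"
  by transfer (simp add: ivec_add inner_add_left exp_add[symmetric] algebra_simps)

text \<open>The inner functional sends \<open>h\<close> to \<open>g\<close>, a translate of \<open>h\<close> multiplied by the character of the
moved base point.  As a function of the arrow \<open>u\<close> that character is a plane wave with frequency
\<open>hbar r\<close>, so \<open>g\<close> is a test function and the outer functional evaluates it at \<open>\<eta> r'/2\<close>; the
plane wave contributes the phase.\<close>

lemma star_Q_f_osc:
  fixes \<eta> :: "real ^ 'n ^ ('n::finite)"
  assumes inv: "invertible \<eta>" and h: "h \<in> Cc_inf (hbar, q)"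
  shows "(Q \<eta> (f_osc r) \<star> Q \<eta> (f_osc r')) (hbar, q) h =
    exp (\<i> * complex_of_real (hbar / 2 * (ivec r \<bullet> (\<eta> *v ivec r')))) * Q \<eta> (f_osc (r + r')) (hbar, q) h"
proof -
  let ?a = "\<eta> *v (ivec r /\<^sub>R 2)" and ?b = "\<eta> *v (ivec r' /\<^sub>R 2)"
  have htest: "test_function (\<lambda>u. h (hbar, u, q))" using h by (simp add: Cc_inf_iff)
  define g where "g = (\<lambda>z\<in>sfibre (hbar, q). Q \<eta> (f_osc r) (gtarget z)
      (\<lambda>x\<in>sfibre (gtarget z). h (gmult x z)))"
  have g: "g (hbar, u, q) = torus_char r q * iexp ((hbar *\<^sub>R ivec r) \<bullet> u) * h (hbar, u + ?a, q)" for u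
  proof -
    have "(\<lambda>x\<in>sfibre (hbar, torus_shift q (hbar *\<^sub>R u)). h (gmult x (hbar, u, q)))
        \<in> Cc_inf (hbar, torus_shift q (hbar *\<^sub>R u))"
      using test_function_translate[OF htest, of u] by (simp add: restrict_sfibre_in_Cc_inf)
    then show ?thesis
      by (simp add: g_def Q_f_osc[OF inv] torus_char_shift add.commute)
  qed
  have "g \<in> extensional (sfibre (hbar, q))" by (simp add: g_def)
  moreover have "test_function (\<lambda>u. g (hbar, u, q))"
    unfolding g by (intro test_function_times_plane_wave test_function_translate htest)
  ultimately have gC: "g \<in> Cc_inf (hbar, q)" by (simp add: Cc_inf_iff)
  have "(Q \<eta> (f_osc r) \<star> Q \<eta> (f_osc r')) (hbar, q) h = Q \<eta> (f_osc r') (hbar, q) g"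
    using h by (simp add: star_def g_def)
  also have "\<dots> = torus_char r' q * (torus_char r q * iexp ((hbar *\<^sub>R ivec r) \<bullet> ?b) * h (hbar, ?b + ?a, q))"
    by (simp only: Q_f_osc[OF inv gC] g)
  also have "(hbar *\<^sub>R ivec r) \<bullet> ?b = hbar / 2 * (ivec r \<bullet> (\<eta> *v ivec r'))"
    by (simp add: matrix_vector_mult_scaleR)
  also have "?b + ?a = \<eta> *v (ivec (r + r') /\<^sub>R 2)"
    by (simp add: ivec_add matrix_vector_right_distrib scaleR_add_right add.commute)
  finally show ?thesis
    by (simp only: Q_f_osc[OF inv h] torus_char_add mult_ac)
qed

text \<open>On \<open>Cc_inf p\<close> the scalar phase moves out of the integral that defines \<open>Q_param\<close>; elsewhere both
families take the value \<open>undefined\<close>.\<close>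

theorem proposition6p1:
  fixes \<eta> :: "real ^ 'n ^ ('n::finite)" and r r' :: "int ^ 'n"
  assumes skew: "transpose \<eta> = - \<eta>"
    and inv: "invertible \<eta>"
  shows "Q \<eta> (f_osc r) \<star> Q \<eta> (f_osc r') =
           Q_param \<eta> (\<lambda>hbar (X, q). exp (\<i> * complex_of_real (hbar / 2 * (ivec r \<bullet> (\<eta> *v ivec r'))))
                                 * f_osc (r + r') (X, q))
       \<and> (\<forall>hbar q. \<forall>h \<in> Cc_inf (hbar, q).
            (Q \<eta> (f_osc r) \<star> Q \<eta> (f_osc r')) (hbar, q) h =
              exp (\<i> * complex_of_real (hbar / 2 * (ivec r \<bullet> (\<eta> *v ivec r'))))
                * Q \<eta> (f_osc (r + r')) (hbar, q) h)"
proof (intro conjI ext allI ballI)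
  fix p :: "'n obj" and h :: "'n arrow \<Rightarrow> complex"
  obtain hbar q where p: "p = (hbar, q)" by (cases p)
  let ?F = "\<lambda>hbar (X, q). exp (\<i> * complex_of_real (hbar / 2 * (ivec r \<bullet> (\<eta> *v ivec r')))) * f_osc (r + r') (X, q)"
  show "(Q \<eta> (f_osc r) \<star> Q \<eta> (f_osc r')) p h = Q_param \<eta> ?F p h"
  proof (cases "h \<in> Cc_inf p")
    case True
    then have "Q_param \<eta> ?F p h = exp (\<i> * complex_of_real (hbar / 2 * (ivec r \<bullet> (\<eta> *v ivec r')))) * Q \<eta> (f_osc (r + r')) p h"
      unfolding p Q_def Q_param_def 
      by (simp only: prod.case restrict_apply' mult.assoc integral_mult_right_zero)
    then show ?thesis using star_Q_f_osc[OF inv] True unfolding p by simp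
  next
    case False
    then show ?thesis unfolding p by (simp add: star_def Q_param_def)
  qed
next
  fix hbar q and h :: "'n arrow \<Rightarrow> complex"
  assume "h \<in> Cc_inf (hbar, q)"
  then show "(Q \<eta> (f_osc r) \<star> Q \<eta> (f_osc r')) (hbar, q) h =
      exp (\<i> * complex_of_real (hbar / 2 * (ivec r \<bullet> (\<eta> *v ivec r')))) * Q \<eta> (f_osc (r + r')) (hbar, q) h"
    by (rule star_Q_f_osc[OF inv])
qed

end
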